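(* Let $g_1,\dots,g_m:\mathbb{R}^n\to\mathbb{R}$ be continuously differentiable, let $G(x)=\mathrm{Diag}(g_1(x),\dots,g_m(x))$ be the associated diagonal matrix function, and let $\bar x\in\mathbb{R}^n$ satisfy $g_1(\bar x)\ge0,\dots,g_m(\bar x)\ge0$. Let $\mathcal{A}(\bar x)=\{i\in\{1,\dots,m\}: g_i(\bar x)=0\}$. Then the following statements are equivalent: 1. weak-CRCQ (for the constraint $G(x)\succeq0$) holds at $\bar x$; 2. for every $J\subseteq\mathcal{A}(\bar x)$, if the family $\{\nabla g_i(\bar x)\}_{i\in J}$ is linearly dependent, then the family $\{\nabla g_i(x)\}_{i\in J}$ is also linearly dependent for every $x$ close enough to $\bar x$.
   Context: $\mathbb{S}^m$ is the space of real symmetric $m\times m$ matrices; $M\succeq 0$ means $M$ is positive semidefinite. $D_{x_i}G(x)$ is the $i$-th partial derivative of $G:\mathbb{R}^n\to\mathbb{S}^m$. Eigenvalues of $M\in\mathbb{S}^m$ are ordered $\lambda_1(M)\ge\dots\ge\lambda_m(M)$. For $0\le r<m$, $\mathcal{E}_r(M)$ is the set of $E\in\mathbb{R}^{m\times(m-r)}$ with $E^\top E=I_{m-r}$ and $ME=E\,\mathrm{Diag}(\lambda_{r+1}(M),\dots,\lambda_m(M))$. For $E$ with columns $e_1,\dots,e_{m-r}$, $v_{ii}(x,E)=[e_i^\top D_{x_1}G(x)e_i,\dots,e_i^\top D_{x_n}G(x)e_i]^\top\in\mathbb{R}^n$. Weak-CRCQ at $\bar x$ with $G(\bar x)\succeq0$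 and $r=\mathrm{rank}\,G(\bar x)$: either $r=m$ or, for each sequence $x^k\to\bar x$, there exist an infinite set $I\subseteq\mathbb{N}$ and matrices $E^k\in\mathcal{E}_r(G(x^k))$, $k\in I$, with $\{E^k\}_{k\in I}$ convergent to some $\bar E$, such that for every $J\subseteq\{1,\dots,m-r\}$: if the family $\{v_{ii}(\bar x,\bar E)\}_{i\in J}$ is linearly dependent, then the family $\{v_{ii}(x^k,E^k)\}_{i\in J}$ is linearly dependent for all sufficiently large $k\in I$. *)

theory Defs
  imports "HOL-Analysis.Analysis" "HOL-Computational_Algebra.Polynomial"
begin

definition partial_deriv :: "'n \<Rightarrow> (real^'n \<Rightarrow> 'b::real_normed_vector) \<Rightarrow> real^'n \<Rightarrow> 'b"
  where "partial_deriv j f x = vector_derivative (\<lambda>t. f (x + t *\<^sub>R axis j 1)) (at 0)"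

definition grad :: "(real^'n \<Rightarrow> real) \<Rightarrow> real^'n \<Rightarrow> real^'n"
  where "grad f x = (\<chi> j. partial_deriv j f x)"

definition continuously_differentiable :: "(real^'n \<Rightarrow> real) \<Rightarrow> bool"
  where "continuously_differentiable f \<longleftrightarrow> (\<forall>x. f differentiable (at x)) \<and> continuous_on UNIV (grad f)"

definition diag_mat :: "('m \<Rightarrow> real) \<Rightarrow> real^'m^'m"
  where "diag_mat d = (\<chi> i j. if i = j then d i else 0)"

definition sym_psd :: "real^'m^'m \<Rightarrow> bool"
  where "sym_psd M \<longleftrightarrow> transpose M = M \<and> (\<forall>u. 0 \<le> u \<bullet> (M *v u))"

text \<open>Linear dependence of a finite indexed family, as opposed to that of its set of values:
  a family with a repeated member is dependent, and the empty family is not.\<close>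

definition lin_dep_family :: "('i \<Rightarrow> 'a::real_vector) \<Rightarrow> 'i set \<Rightarrow> bool"
  where "lin_dep_family v J \<longleftrightarrow> (\<exists>c. (\<exists>i\<in>J. c i \<noteq> 0) \<and> (\<Sum>i\<in>J. c i *\<^sub>R v i) = 0)"

definition charpoly :: "real^'m^'m \<Rightarrow> real poly"
  where "charpoly M = det (\<chi> i j. if i = j then [:- M $ i $ j, 1:] else [:- M $ i $ j:])"

text \<open>\<open>eigval M k\<close> is the \<open>k\<close>-th largest eigenvalue of a symmetric \<open>M\<close>, counted with multiplicity,
  for \<open>1 \<le> k \<le> m\<close>.\<close>

definition eigval :: "real^'m^'m \<Rightarrow> nat \<Rightarrow> real"
  where "eigval M k = rev (sorted_list_of_multiset (proots (charpoly M))) ! (k - 1)"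

text \<open>An \<open>m \<times> (m - r)\<close> matrix is represented by its columns \<open>E 1, \<dots>, E (m - r)\<close>, because the number
  of columns is not fixed by a type. Values of \<open>E\<close> outside this range are irrelevant. The two conditions
  are the entries of \<open>E\<^sup>T E = I\<close> and the columns of
  \<open>M E = E Diag(\<lambda>\<^bsub>r+1\<^esub>(M), \<dots>, \<lambda>\<^bsub>m\<^esub>(M))\<close>.\<close>

definition eigvec_mats :: "nat \<Rightarrow> real^'m^'m \<Rightarrow> (nat \<Rightarrow> real^'m) set"
  where "eigvec_mats r M = {E.
    (\<forall>i\<in>{1..CARD('m) - r}. \<forall>j\<in>{1..CARD('m) - r}. E i \<bullet> E j = (if i = j then 1 else 0)) \<and>
    (\<forall>i\<in>{1..CARD('m) - r}. M *v E i = eigval M (r + i) *\<^sub>R E i)}"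

definition v_diag :: "(real^'n \<Rightarrow> real^'m^'m) \<Rightarrow> real^'n \<Rightarrow> (nat \<Rightarrow> real^'m) \<Rightarrow> nat \<Rightarrow> real^'n"
  where "v_diag G x E i = (\<chi> j. E i \<bullet> (partial_deriv j G x *v E i))"

text \<open>The notion is meant for \<open>G\<close> with symmetric values. The filter \<open>inf sequentially (principal I)\<close>
  describes \<open>k \<rightarrow> \<infinity>\<close> with \<open>k \<in> I\<close>; convergence of the matrices is that of their columns.\<close>

definition weak_CRCQ :: "(real^'n \<Rightarrow> real^'m^'m) \<Rightarrow> real^'n \<Rightarrow> bool"
  where "weak_CRCQ G xbar \<longleftrightarrow> sym_psd (G xbar) \<and>
    (let m = CARD('m); r = rank (G xbar) in
      r = m \<or>
      (\<forall>x :: nat \<Rightarrow> real^'n. x \<longlonglongrightarrow> xbar \<longrightarrow>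
        (\<exists>(I :: nat set) (E :: nat \<Rightarrow> nat \<Rightarrow> real^'m) (Ebar :: nat \<Rightarrow> real^'m).
          infinite I \<and>
          (\<forall>k\<in>I. E k \<in> eigvec_mats r (G (x k))) \<and>
          (\<forall>i\<in>{1..m - r}. ((\<lambda>k. E k i) \<longlongrightarrow> Ebar i) (inf sequentially (principal I))) \<and>
          (\<forall>J\<subseteq>{1..m - r}. lin_dep_family (v_diag G xbar Ebar) J \<longrightarrow>
            (\<forall>\<^sub>F k in inf sequentially (principal I).
              lin_dep_family (v_diag G (x k) (E k)) J)))))"

end

theory Submission
  imports Defs
begin

text \<open>Near \<open>xbar\<close> the \<open>m - r\<close> smallest eigenvalues of \<open>G(x)\<close> are the values of the active constraints.
  If the gradients satisfy the constant rank condition, coordinate vectors serve as eigenvectors, and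
  on a subsequence the order of the active values does not change, so the \<open>v\<^bsub>ii\<^esub>\<close> are the active
  gradients in a fixed order. Conversely, if some dependent gradients become independent at points
  \<open>x\<^sup>k \<rightarrow> xbar\<close>, these points can be moved slightly so that constraints with equal values at \<open>x\<^sup>k\<close>
  agree near \<open>x\<^sup>k\<close>; then every \<open>v\<^bsub>ii\<^esub>\<close> is the gradient of a single constraint, whatever the
  eigenvectors, and weak-CRCQ is violated.\<close>

subsection \<open>Linearly dependent families\<close>

lemma lin_dep_family_cong:
  assumes "\<And>i. i \<in> J \<Longrightarrow> v i = w i"
  shows "lin_dep_family v J \<longleftrightarrow> lin_dep_family w J"
  unfolding lin_dep_family_def using assms by (simp cong: sum.cong)

lemma lin_dep_family_reindex:
  assumes "inj_on s J"
  shows "lin_dep_family v (s ` J) \<longleftrightarrow> lin_dep_family (\<lambda>j. v (s j)) J"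
proof
  assume "lin_dep_family v (s ` J)"
  then obtain c where "\<exists>i\<in>s ` J. c i \<noteq> 0" "(\<Sum>i\<in>s ` J. c i *\<^sub>R v i) = 0"
    unfolding lin_dep_family_def by blast
  then show "lin_dep_family (\<lambda>j. v (s j)) J"
    unfolding lin_dep_family_def using assms
    by (intro exI[of _ "c \<circ> s"]) (auto simp: sum.reindex)
next
  assume "lin_dep_family (\<lambda>j. v (s j)) J"
  then obtain c where c: "\<exists>j\<in>J. c j \<noteq> 0" "(\<Sum>j\<in>J. c j *\<^sub>R v (s j)) = 0"
    unfolding lin_dep_family_def by blast
  have "(\<Sum>j\<in>J. c (the_inv_into J s (s j)) *\<^sub>R v (s j)) = (\<Sum>j\<in>J. c j *\<^sub>R v (s j))"
    using assms by (intro sum.cong) (auto simp: the_inv_into_f_f)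
  with c assms show "lin_dep_family v (s ` J)"
    unfolding lin_dep_family_def
    by (intro exI[of _ "c \<circ> the_inv_into J s"]) (auto simp: sum.reindex the_inv_into_f_f)
qed

text \<open>The coefficients 1 and -1 cancel the repeated member. Later, independence of the
  gradients thereby forces different constraints to use different columns.\<close>

lemma lin_dep_family_eq_members:
  assumes "finite J" "a \<in> J" "b \<in> J" "a \<noteq> b" "v a = v b"
  shows "lin_dep_family v J"
proof -
  let ?c = "\<lambda>i. if i = a then 1 else if i = b then - 1 else 0 :: real"
  have "(\<Sum>i\<in>J. ?c i *\<^sub>R v i) = (\<Sum>i\<in>{a, b}. ?c i *\<^sub>R v i)"
    using assms by (intro sum.mono_neutral_right) auto
  also have "\<dots> = 0"
    using assms by simp
  finally show ?thesis
    unfolding lin_dep_family_def using assms(2) by (intro exI[of _ ?c]) auto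
qed

text \<open>Extending the coefficients by zero and normalising them puts them on the unit sphere of
  a fixed space, so that compactness becomes available.\<close>

lemma lin_dep_family_unit_vector:
  fixes v :: "'m::finite \<Rightarrow> 'a::real_vector"
  shows "lin_dep_family v J \<longleftrightarrow>
    (\<exists>c :: real^'m. norm c = 1 \<and> (\<forall>i. i \<notin> J \<longrightarrow> c $ i = 0) \<and> (\<Sum>i\<in>UNIV. c $ i *\<^sub>R v i) = 0)"
proof
  assume "lin_dep_family v J"
  then obtain c where c: "\<exists>i\<in>J. c i \<noteq> 0" "(\<Sum>i\<in>J. c i *\<^sub>R v i) = 0"
    unfolding lin_dep_family_def by blast
  define e :: "real^'m" where "e = (\<chi> i. if i \<in> J then c i else 0)"
  have "e \<noteq> 0"
    using c(1) by (auto simp: e_def vec_eq_iff)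
  have "(\<Sum>i\<in>UNIV. e $ i *\<^sub>R v i) = (\<Sum>i\<in>J. c i *\<^sub>R v i)"
    by (rule sum.mono_neutral_cong_right) (auto simp: e_def)
  with c have "(\<Sum>i\<in>UNIV. (e /\<^sub>R norm e) $ i *\<^sub>R v i) = 0"
    by (simp flip: scaleR_scaleR scaleR_sum_right)
  then show "\<exists>c :: real^'m. norm c = 1 \<and> (\<forall>i. i \<notin> J \<longrightarrow> c $ i = 0) \<and> (\<Sum>i\<in>UNIV. c $ i *\<^sub>R v i) = 0"
    using \<open>e \<noteq> 0\<close> by (intro exI[of _ "e /\<^sub>R norm e"]) (auto simp: e_def)
next
  assume "\<exists>c :: real^'m. norm c = 1 \<and> (\<forall>i. i \<notin> J \<longrightarrow> c $ i = 0) \<and> (\<Sum>i\<in>UNIV. c $ i *\<^sub>R v i) = 0"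
  then obtain c :: "real^'m" where c: "norm c = 1" "\<And>i. i \<notin> J \<Longrightarrow> c $ i = 0"
    "(\<Sum>i\<in>UNIV. c $ i *\<^sub>R v i) = 0" by blast
  have "c \<noteq> 0"
    using c(1) by auto
  then have "\<exists>i\<in>J. c $ i \<noteq> 0"
    using c(2) by (metis vec_eq_iff zero_index)
  moreover have "(\<Sum>i\<in>J. c $ i *\<^sub>R v i) = (\<Sum>i\<in>UNIV. c $ i *\<^sub>R v i)"
    using c(2) by (intro sum.mono_neutral_left) auto
  ultimately show "lin_dep_family v J"
    unfolding lin_dep_family_def using c(3) by auto
qed

text \<open>Unit coefficient vectors at the points of a convergent sequence have a convergent
  subsequence. Its limit is again a unit vector, supported in \<open>J\<close>, and by continuity
  gives a vanishing combination at the limit point. Hence independence is an open condition and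
  survives small moves of a point.\<close>

lemma closed_lin_dep_family:
  fixes v :: "'m::finite \<Rightarrow> 'a::metric_space \<Rightarrow> 'b::real_normed_vector"
  assumes "\<And>i. continuous_on UNIV (v i)"
  shows "closed {x. lin_dep_family (\<lambda>i. v i x) J}"
  unfolding closed_sequential_limits
proof (intro allI impI, elim conjE)
  fix X l assume X: "\<forall>n. X n \<in> {x. lin_dep_family (\<lambda>i. v i x) J}" "X \<longlonglongrightarrow> l"
  then have "\<forall>n. \<exists>c :: real^'m. norm c = 1 \<and> (\<forall>i. i \<notin> J \<longrightarrow> c $ i = 0) \<and>
      (\<Sum>i\<in>UNIV. c $ i *\<^sub>R v i (X n)) = 0"
    by (simp add: lin_dep_family_unit_vector)
  then obtain c :: "nat \<Rightarrow> real^'m" where c: "\<And>n. norm (c n) = 1"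
    "\<And>n i. i \<notin> J \<Longrightarrow> c n $ i = 0" "\<And>n. (\<Sum>i\<in>UNIV. c n $ i *\<^sub>R v i (X n)) = 0"
    by metis
  obtain d r where d: "d \<in> sphere (0 :: real^'m) 1" "strict_mono (r :: nat \<Rightarrow> nat)" "(c \<circ> r) \<longlonglongrightarrow> d"
    using compact_sphere[of "0 :: real^'m" 1] c(1) unfolding compact_def
    by (metis dist_0_norm mem_sphere)
  have lim: "(\<lambda>n. c (r n) $ i) \<longlonglongrightarrow> d $ i" for i
    using tendsto_vec_nth[OF d(3)] by (simp add: o_def)
  have "d $ i = 0" if "i \<notin> J" for i
    using lim[of i] that by (simp add: c(2) LIMSEQ_const_iff)
  moreover have "(\<Sum>i\<in>UNIV. d $ i *\<^sub>R v i l) = 0"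
  proof -
    have "(\<lambda>n. v i (X (r n))) \<longlonglongrightarrow> v i l" for i
    proof -
      have "(\<lambda>n. X (r n)) \<longlonglongrightarrow> l"
        using LIMSEQ_subseq_LIMSEQ[OF X(2) d(2)] by (simp add: o_def)
      then show ?thesis
        using continuous_on_tendsto_compose[OF assms] by simp
    qed
    then have "(\<lambda>n. \<Sum>i\<in>UNIV. c (r n) $ i *\<^sub>R v i (X (r n))) \<longlonglongrightarrow> (\<Sum>i\<in>UNIV. d $ i *\<^sub>R v i l)"
      by (intro tendsto_intros lim)
    then show ?thesis
      by (simp add: c(3) LIMSEQ_const_iff)
  qed
  ultimately show "l \<in> {x. lin_dep_family (\<lambda>i. v i x) J}"
    using d(1) by (auto simp: lin_dep_family_unit_vector)
qed

subsection \<open>Diagonal matrices\<close>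

lemma charpoly_diag_mat: "charpoly (diag_mat d) = (\<Prod>i\<in>UNIV. [:- d i, 1:])"
  unfolding charpoly_def diag_mat_def by (subst det_diagonal) auto

lemma proots_charpoly_diag_mat:
  fixes d :: "'m::finite \<Rightarrow> real"
  shows "proots (charpoly (diag_mat d)) = image_mset d (mset_set UNIV)"
proof -
  have "proots (\<Prod>i\<in>A. [:- d i, 1:]) = image_mset d (mset_set A)" if "finite A" for A
    using that
  proof (induction rule: finite_induct)
    case (insert a A)
    have "(\<Prod>i\<in>A. [:- d i, 1:]) \<noteq> 0"
      using insert.hyps(1) by (simp add: prod_zero_iff)
    then show ?case
      using insert by (simp add: proots_mult del: mult_pCons_left)
  qed simp
  then show ?thesis
    by (simp add: charpoly_diag_mat)
qed

text \<open>The eigenvalues are the diagonal entries. By the separation hypothesis, sorting the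
  entries over \<open>A\<close> and those over its complement separately and concatenating gives a
  sorted list, so \<open>A\<close> supplies the smallest eigenvalues.\<close>

lemma eigval_diag_mat_smallest:
  fixes d :: "'m::finite \<Rightarrow> real"
  assumes sep: "\<And>a b. a \<in> A \<Longrightarrow> b \<notin> A \<Longrightarrow> d a < d b" and card: "card A = CARD('m) - r"
  shows "\<exists>zs. distinct zs \<and> set zs = A \<and>
    (\<forall>i\<in>{1..CARD('m) - r}. eigval (diag_mat d) (r + i) = d (zs ! (CARD('m) - r - i)))"
proof -
  obtain xs where xs: "set xs = A" "distinct xs"
    using finite_distinct_list[of A] by auto
  obtain ys where ys: "set ys = - A" "distinct ys"
    using finite_distinct_list[of "- A"] by auto
  define zs where "zs = sort_key d xs"
  define ws where "ws = zs @ sort_key d ys"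
  have "distinct ws" and set_ws: "set ws = UNIV"
    using xs ys by (auto simp: ws_def zs_def)
  then have len: "length ws = CARD('m)"
    by (metis distinct_card)
  have len_zs: "length zs = CARD('m) - r"
    using xs card distinct_card[of xs] by (simp add: zs_def)
  have "sorted (map d ws)"
    using xs(1) ys(1) by (auto simp: ws_def zs_def sorted_append intro: less_imp_le sep)
  moreover have "mset ws = mset_set UNIV"
    using \<open>distinct ws\<close> set_ws by (metis mset_set_set)
  then have "proots (charpoly (diag_mat d)) = mset (map d ws)"
    by (simp add: proots_charpoly_diag_mat)
  ultimately have eq: "sorted_list_of_multiset (proots (charpoly (diag_mat d))) = map d ws"
    by (simp add: sorted_sort_id del: mset_map)
  have "eigval (diag_mat d) (r + i) = d (zs ! (CARD('m) - r - i))"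
    if i: "i \<in> {1..CARD('m) - r}" for i
  proof -
    have "eigval (diag_mat d) (r + i) = rev (map d ws) ! (r + i - 1)"
      by (simp add: eigval_def eq)
    \<comment> \<open>\<open>eigval\<close> counts from 1 in descending order and \<open>ws\<close>
      from 0 in ascending order. For \<open>i\<close> from 1 to \<open>m - r\<close> the position
      found is below \<open>length zs\<close>, so it lies in the block of \<open>A\<close>.\<close>
    also have "\<dots> = d (ws ! (CARD('m) - r - i))"
      using i by (subst rev_nth) (auto simp: len)
    also have "\<dots> = d (zs ! (CARD('m) - r - i))"
      using i len_zs by (auto simp: ws_def nth_append)
    finally show ?thesis .
  qed
  moreover have "distinct zs" "set zs = A"
    using xs by (auto simp: zs_def)
  ultimately show ?thesis by blast
qed

text \<open>The index \<open>length zs - i\<close> is the one produced by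
  \<open>eigval_diag_mat_smallest\<close>; this matches columns with active constraints one to
  one.\<close>

lemma bij_betw_rev_nth:
  assumes "distinct zs"
  shows "bij_betw (\<lambda>i. zs ! (length zs - i)) {1..length zs} (set zs)"
proof -
  have "bij_betw (\<lambda>i. length zs - i) {1..length zs} {..<length zs}"
    by (rule bij_betw_byWitness[where f' = "\<lambda>i. length zs - i"]) auto
  from bij_betw_trans[OF this bij_betw_nth[OF assms refl refl]] show ?thesis
    by (simp add: o_def)
qed

lemma diag_mat_mult_vec: "diag_mat d *v u = (\<chi> i. d i * u $ i)"
  by (simp add: vec_eq_iff matrix_vector_mult_def diag_mat_def if_distrib[of "\<lambda>x. x * _"] cong: if_cong)

lemma rank_diag_mat:
  fixes d :: "'m::finite \<Rightarrow> real"
  shows "rank (diag_mat d) = card {i. d i \<noteq> 0}"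
proof -
  let ?B = "(\<lambda>i. axis i (1::real) :: real^'m) ` {i. d i \<noteq> 0}"
  have col: "column i (diag_mat d) = d i *\<^sub>R axis i 1" for i
    by (auto simp: column_def diag_mat_def axis_def vec_eq_iff)
  have "span (columns (diag_mat d)) = span ?B"
  proof (rule span_eq[THEN iffD2], rule conjI)
    show "columns (diag_mat d) \<subseteq> span ?B"
    proof
      fix c assume "c \<in> columns (diag_mat d)"
      then obtain i where c: "c = d i *\<^sub>R axis i 1"
        by (auto simp: columns_def col)
      show "c \<in> span ?B"
        by (cases "d i = 0") (auto simp: c span_zero intro!: span_scale[OF span_base])
    qed
    show "?B \<subseteq> span (columns (diag_mat d))"
    proof
      fix b assume "b \<in> ?B"
      then obtain i where i: "d i \<noteq> 0" "b = axis i 1" by auto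
      have "(1 / d i) *\<^sub>R column i (diag_mat d) \<in> span (columns (diag_mat d))"
        by (intro span_scale span_base) (auto simp: columns_def)
      then show "b \<in> span (columns (diag_mat d))"
        using i by (simp add: col)
    qed
  qed
  then have "rank (diag_mat d) = dim ?B"
    by (metis column_rank_def dim_span)
  also have "\<dots> = card ?B"
  proof (rule dim_eq_card_independent)
    show "independent ?B"
      by (rule independent_mono[OF independent_Basis]) (auto simp: axis_in_Basis_iff)
  qed
  also have "\<dots> = card {i. d i \<noteq> 0}"
    by (rule card_image) (auto simp: inj_on_def axis_eq_axis)
  finally show ?thesis .
qed

text \<open>Applied at \<open>xbar\<close>, this identifies the number of active constraints with
  the number \<open>m - r\<close> of columns in weak-CRCQ.\<close>

lemma card_zeros_diag_mat:
  fixes d :: "'m::finite \<Rightarrow> real"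
  shows "card {i. d i = 0} = CARD('m) - rank (diag_mat d)"
proof -
  have "{i. d i = 0} = UNIV - {i. d i \<noteq> 0}"
    by blast
  then show ?thesis
    by (simp add: rank_diag_mat card_Diff_subset)
qed

lemma sym_psd_diag_mat:
  assumes "\<And>i. 0 \<le> d i"
  shows "sym_psd (diag_mat d)"
  unfolding sym_psd_def
proof
  show "transpose (diag_mat d) = diag_mat d"
    by (auto simp: transpose_def diag_mat_def vec_eq_iff)
  have "0 \<le> u \<bullet> (diag_mat d *v u)" for u
  proof -
    have "u \<bullet> (diag_mat d *v u) = (\<Sum>i\<in>UNIV. d i * (u $ i)\<^sup>2)"
      by (simp add: diag_mat_mult_vec inner_vec_def power2_eq_square algebra_simps)
    then show ?thesis
      using assms by (simp add: sum_nonneg)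
  qed
  then show "\<forall>u. 0 \<le> u \<bullet> (diag_mat d *v u)" by blast
qed

subsection \<open>Derivatives\<close>

lemma has_vector_derivative_along_axis:
  fixes f :: "real^'n \<Rightarrow> real"
  assumes "f differentiable (at x)"
  shows "((\<lambda>t. f (x + t *\<^sub>R axis j 1)) has_vector_derivative partial_deriv j f x) (at 0)"
proof -
  have "(\<lambda>t. f (x + t *\<^sub>R axis j 1)) differentiable (at (0::real))"
    using differentiable_chain_at[of "\<lambda>t::real. x + t *\<^sub>R axis j 1" 0 f] assms
    by (simp add: o_def)
  then show ?thesis
    unfolding partial_deriv_def by (simp add: vector_derivative_works)
qed

lemma partial_deriv_diag_mat:
  fixes g :: "'m::finite \<Rightarrow> real^'n \<Rightarrow> real"
  assumes "\<And>i. g i differentiable (at x)"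
  shows "partial_deriv j (\<lambda>x. diag_mat (\<lambda>i. g i x)) x = diag_mat (\<lambda>i. partial_deriv j (g i) x)"
proof -
  have "((\<lambda>t. diag_mat (\<lambda>i. g i (x + t *\<^sub>R axis j 1))) has_vector_derivative
      diag_mat (\<lambda>i. partial_deriv j (g i) x)) (at 0)"
  proof -
    have "((\<lambda>t. if i = l then g i (x + t *\<^sub>R axis j 1) else 0) has_vector_derivative
        (if i = l then partial_deriv j (g i) x else 0)) (at 0)" for i l
      using has_vector_derivative_along_axis[OF assms] by simp
    then show ?thesis
      unfolding diag_mat_def has_vector_derivative_def
      by (simp add: has_derivative_componentwise_within[where 'b = "real^'m^'m"] Basis_vec_def inner_axis)
  qed
  then show ?thesis
    unfolding partial_deriv_def[of j "\<lambda>x. diag_mat (\<lambda>i. g i x)"] by (rule vector_derivative_at)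
qed

text \<open>For a unit vector \<open>E i\<close> the weights are nonnegative with sum 1, so this is
  a convex combination of gradients. It also shows how the left side depends on \<open>x\<close> and
  \<open>E\<close>, which gives its limits.\<close>

lemma v_diag_diag_mat:
  fixes g :: "'m::finite \<Rightarrow> real^'n \<Rightarrow> real"
  assumes "\<And>i. g i differentiable (at x)"
  shows "v_diag (\<lambda>x. diag_mat (\<lambda>i. g i x)) x E i = (\<Sum>l\<in>UNIV. (E i $ l)\<^sup>2 *\<^sub>R grad (g l) x)"
  by (simp add: v_diag_def partial_deriv_diag_mat[OF assms] diag_mat_mult_vec inner_vec_def
      vec_eq_iff grad_def power2_eq_square algebra_simps)

lemma grad_cong_open:
  assumes "open V" "y \<in> V" "\<And>z. z \<in> V \<Longrightarrow> f z = h z"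
  shows "grad f y = grad h y"
proof -
  have "partial_deriv j f y = partial_deriv j h y" for j
  proof -
    have "((\<lambda>t. y + t *\<^sub>R axis j 1) \<longlongrightarrow> y + 0 *\<^sub>R axis j 1) (nhds (0::real))"
      by (intro tendsto_intros filterlim_ident)
    then have "\<forall>\<^sub>F t in nhds (0::real). y + t *\<^sub>R axis j 1 \<in> V"
      using assms(1,2) by (auto intro: topological_tendstoD)
    then have "\<forall>\<^sub>F t in nhds (0::real). f (y + t *\<^sub>R axis j 1) = h (y + t *\<^sub>R axis j 1)"
      by eventually_elim (rule assms(3))
    then show ?thesis
      unfolding partial_deriv_def by (intro vector_derivative_cong_eq) auto
  qed
  then show ?thesis by (simp add: grad_def)
qed

text \<open>Pairs are treated one at a time: if two functions differ somewhere on the current open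
  set, it is shrunk to the open part where they differ. The alternatives already settled pass to
  subsets. In the resulting set, equality at a point means equality around it, hence equal
  gradients.\<close>

lemma open_subset_equal_or_nowhere_equal:
  fixes g :: "'i::finite \<Rightarrow> 'a::topological_space \<Rightarrow> 'b::t2_space"
  assumes cont: "\<And>i. continuous_on UNIV (g i)" and "open U" "U \<noteq> {}"
  shows "\<exists>V. open V \<and> V \<noteq> {} \<and> V \<subseteq> U \<and>
    (\<forall>i j. (\<forall>y\<in>V. g i y = g j y) \<or> (\<forall>y\<in>V. g i y \<noteq> g j y))"
proof -
  have "\<exists>V. open V \<and> V \<noteq> {} \<and> V \<subseteq> U \<and>
      (\<forall>(i, j)\<in>P. (\<forall>y\<in>V. g i y = g j y) \<or> (\<forall>y\<in>V. g i y \<noteq> g j y))" if "finite P" for P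
    using that
  proof (induction rule: finite_induct)
    case empty
    then show ?case using assms(2,3) by auto
  next
    case (insert p P)
    then obtain V where V: "open V" "V \<noteq> {}" "V \<subseteq> U"
      "\<forall>(i, j)\<in>P. (\<forall>y\<in>V. g i y = g j y) \<or> (\<forall>y\<in>V. g i y \<noteq> g j y)" by blast
    obtain i j where p: "p = (i, j)" by (cases p)
    show ?case
    proof (cases "\<forall>y\<in>V. g i y = g j y")
      case True
      then show ?thesis using V p by (intro exI[of _ V]) auto
    next
      case False
      have "open (V \<inter> {y. g i y \<noteq> g j y})"
        using V(1) open_Collect_neq[OF cont cont] by (intro open_Int) auto
      then show ?thesis
        using False V p by (intro exI[of _ "V \<inter> {y. g i y \<noteq> g j y}"]) fastforce
    qed
  qed
  from this[of UNIV] show ?thesis by simp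
qed

subsection \<open>The equivalence\<close>

lemma continuously_differentiableD:
  assumes "continuously_differentiable f"
  shows "f differentiable (at x)" "continuous_on UNIV f" "continuous_on UNIV (grad f)"
  using assms differentiable_imp_continuous_on[of f UNIV]
  by (auto simp: continuously_differentiable_def differentiable_on_def)

text \<open>At \<open>xbar\<close> inactive values are positive and active ones zero, and continuity
  keeps the strict inequality nearby. This is the separation required by
  \<open>eigval_diag_mat_smallest\<close>.\<close>

lemma eventually_active_less_inactive:
  fixes g :: "'m::finite \<Rightarrow> 'a::topological_space \<Rightarrow> real"
  assumes cont: "\<And>i. continuous_on UNIV (g i)" and nonneg: "\<And>i. 0 \<le> g i xbar"
  shows "\<forall>\<^sub>F x in nhds xbar. \<forall>a b. g a xbar = 0 \<longrightarrow> g b xbar \<noteq> 0 \<longrightarrow> g a x < g b x"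
proof -
  have "\<forall>\<^sub>F x in nhds xbar. g a xbar = 0 \<longrightarrow> g b xbar \<noteq> 0 \<longrightarrow> g a x < g b x" for a b
  proof (cases "g a xbar = 0 \<and> g b xbar \<noteq> 0")
    case True
    have "open {x. g a x < g b x}"
      by (intro open_Collect_less cont)
    moreover have "xbar \<in> {x. g a x < g b x}"
      using True nonneg[of b] by simp
    ultimately show ?thesis
      using eventually_nhds_in_open[of "{x. g a x < g b x}" xbar] by simp
  qed auto
  then show ?thesis
    by (simp add: eventually_all_finite)
qed

text \<open>An eigenvector of a diagonal matrix is supported on the indices whose entry is the
  eigenvalue. All gradients with nonzero weight therefore coincide, and the convex combination
  collapses however the eigenvector is chosen.\<close>

lemma v_diag_diag_mat_eigenvector:
  fixes g :: "'m::finite \<Rightarrow> real^'n \<Rightarrow> real"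
  assumes diff: "\<And>i. g i differentiable (at x)"
    and eig: "diag_mat (\<lambda>i. g i x) *v E i = g j x *\<^sub>R E i" and unit: "E i \<bullet> E i = 1"
    and grad: "\<And>l. g l x = g j x \<Longrightarrow> grad (g l) x = grad (g j) x"
  shows "v_diag (\<lambda>x. diag_mat (\<lambda>i. g i x)) x E i = grad (g j) x"
proof -
  have "(E i $ l)\<^sup>2 *\<^sub>R grad (g l) x = (E i $ l)\<^sup>2 *\<^sub>R grad (g j) x" for l
  proof (cases "E i $ l = 0")
    case False
    have "g l x * E i $ l = g j x * E i $ l"
      using eig by (simp add: diag_mat_mult_vec vec_eq_iff)
    with False grad[of l] show ?thesis by simp
  qed simp
  then have "v_diag (\<lambda>x. diag_mat (\<lambda>i. g i x)) x E i = (\<Sum>l\<in>UNIV. (E i $ l)\<^sup>2) *\<^sub>R grad (g j) x"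
    unfolding v_diag_diag_mat[OF diff] scaleR_sum_left by (intro sum.cong) auto
  also have "(\<Sum>l\<in>UNIV. (E i $ l)\<^sup>2) = 1"
    using unit by (simp add: inner_vec_def power2_eq_square)
  finally show ?thesis by simp
qed

lemma weak_CRCQ_diag_mat_if:
  fixes g :: "'m::finite \<Rightarrow> real^'n \<Rightarrow> real" and xbar :: "real^'n"
  assumes cd: "\<And>i. continuously_differentiable (g i)"
    and nonneg: "\<And>i. 0 \<le> g i xbar"
    and CRCQ: "\<And>J. J \<subseteq> {i. g i xbar = 0} \<Longrightarrow> lin_dep_family (\<lambda>i. grad (g i) xbar) J \<Longrightarrow>
      \<forall>\<^sub>F x in nhds xbar. lin_dep_family (\<lambda>i. grad (g i) x) J"
  shows "weak_CRCQ (\<lambda>x. diag_mat (\<lambda>i. g i x)) xbar"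
proof -
  define G where "G = (\<lambda>x. diag_mat (\<lambda>i. g i x))"
  define A where "A = {i. g i xbar = 0}"
  define r where "r = rank (G xbar)"
  define q where "q = CARD('m) - r"
  have card: "card A = q"
    by (simp add: A_def q_def r_def G_def card_zeros_diag_mat)
  have "\<exists>I E Ebar. infinite I \<and> (\<forall>k\<in>I. E k \<in> eigvec_mats r (G (x k))) \<and>
      (\<forall>i\<in>{1..q}. ((\<lambda>k. E k i) \<longlongrightarrow> Ebar i) (inf sequentially (principal I))) \<and>
      (\<forall>J\<subseteq>{1..q}. lin_dep_family (v_diag G xbar Ebar) J \<longrightarrow>
        (\<forall>\<^sub>F k in inf sequentially (principal I). lin_dep_family (v_diag G (x k) (E k)) J))"
    if x: "x \<longlonglongrightarrow> xbar" for x :: "nat \<Rightarrow> real^'n"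
  proof -
    let ?sorts = "\<lambda>k zs. distinct zs \<and> set zs = A \<and>
      (\<forall>i\<in>{1..q}. eigval (G (x k)) (r + i) = g (zs ! (q - i)) (x k))"
    have "\<forall>\<^sub>F k in sequentially. \<forall>a b. g a xbar = 0 \<longrightarrow> g b xbar \<noteq> 0 \<longrightarrow> g a (x k) < g b (x k)"
      using x cd nonneg
      by (intro eventually_compose_filterlim[OF eventually_active_less_inactive])
        (auto intro: continuously_differentiableD)
    then have "\<forall>\<^sub>F k in sequentially. \<exists>zs. ?sorts k zs"
    proof eventually_elim
      case (elim k)
      show ?case
        using eigval_diag_mat_smallest[of A "\<lambda>i. g i (x k)" r] elim card
        by (simp add: G_def A_def q_def)
    qed
    then obtain N where "\<forall>k\<ge>N. \<exists>zs. ?sorts k zs"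
      unfolding eventually_sequentially by blast
    then obtain Z where Z: "\<And>k. k \<ge> N \<Longrightarrow> ?sorts k (Z k)"
      by metis
    \<comment> \<open>There are only finitely many orders of the active constraints, so one of them
      occurs for infinitely many \<open>k\<close>.\<close>
    have "Z ` {N..} \<subseteq> {zs. set zs \<subseteq> A \<and> length zs = q}"
      using Z card distinct_card by fastforce
    then have "finite (Z ` {N..})"
      by (rule finite_subset) (rule finite_lists_length_eq, simp)
    then obtain k0 where k0: "k0 \<ge> N" and inf: "infinite {k \<in> {N..}. Z k = Z k0}"
      using pigeonhole_infinite[of "{N..}" Z] by (auto simp: infinite_Ici)
    define I where "I = {k \<in> {N..}. Z k = Z k0}"
    \<comment> \<open>\<open>s i\<close> is the constraint whose value at \<open>x k\<close> is the
      eigenvalue with index \<open>r + i\<close>, for every \<open>k\<close> in \<open>I\<close>.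
      The coordinate vectors \<open>E\<close> therefore do not depend on \<open>k\<close>, and
      convergence is trivial with \<open>E\<close> itself as the limit.\<close>
    define s where "s = (\<lambda>i. Z k0 ! (q - i))"
    define E where "E = (\<lambda>i. axis (s i) (1::real) :: real^'m)"
    have "length (Z k0) = q"
      using Z[OF k0] card distinct_card by fastforce
    then have s: "bij_betw s {1..q} A"
      using bij_betw_rev_nth[of "Z k0"] Z[OF k0] by (simp add: s_def)
    have "E \<in> eigvec_mats r (G (x k))" if "k \<in> I" for k
    proof -
      have "E i \<bullet> E j = (if i = j then 1 else 0)" if "i \<in> {1..q}" "j \<in> {1..q}" for i j
        using inj_on_eq_iff[OF bij_betw_imp_inj_on[OF s] that] by (simp add: E_def inner_axis_axis)
      moreover have "G (x k) *v E i = eigval (G (x k)) (r + i) *\<^sub>R E i" if "i \<in> {1..q}" for i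
      proof -
        have "eigval (G (x k)) (r + i) = g (s i) (x k)"
          using Z[of k] \<open>k \<in> I\<close> that by (simp add: I_def s_def)
        then show ?thesis
          by (auto simp: G_def E_def diag_mat_mult_vec vec_eq_iff axis_def)
      qed
      ultimately show ?thesis
        by (simp add: eigvec_mats_def q_def)
    qed
    moreover have "\<forall>\<^sub>F k in inf sequentially (principal I). lin_dep_family (v_diag G (x k) E) J"
      if J: "J \<subseteq> {1..q}" "lin_dep_family (v_diag G xbar E) J" for J
    proof -
      have "v_diag G y E i = grad (g (s i)) y" for y i
      proof -
        have "(\<Sum>l\<in>UNIV. (E i $ l)\<^sup>2 *\<^sub>R grad (g l) y) = (\<Sum>l\<in>UNIV. if l = s i then grad (g l) y else 0)"
          by (intro sum.cong) (auto simp: E_def axis_def)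
        then show ?thesis
          using v_diag_diag_mat[of g y E i] cd by (simp add: G_def continuously_differentiableD(1))
      qed
      moreover have "inj_on s J"
        using s J(1) by (auto simp: bij_betw_def intro: inj_on_subset)
      ultimately have dep: "lin_dep_family (v_diag G y E) J \<longleftrightarrow> lin_dep_family (\<lambda>i. grad (g i) y) (s ` J)" for y
        by (simp add: lin_dep_family_reindex cong: lin_dep_family_cong)
      have "s ` J \<subseteq> {i. g i xbar = 0}"
        using s J(1) by (auto simp: bij_betw_def A_def)
      then have "\<forall>\<^sub>F y in nhds xbar. lin_dep_family (v_diag G y E) J"
        using CRCQ J(2) by (simp add: dep)
      then have "\<forall>\<^sub>F k in sequentially. lin_dep_family (v_diag G (x k) E) J"
        using x by (rule eventually_compose_filterlim)
      then show ?thesis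
        by (simp add: eventually_inf_principal eventually_mono)
    qed
    ultimately show ?thesis
      using inf by (intro exI[of _ I] exI[of _ "\<lambda>_. E"] exI[of _ E]) (simp add: I_def)
  qed
  moreover have "sym_psd (G xbar)"
    using nonneg by (simp add: G_def sym_psd_diag_mat)
  ultimately have "weak_CRCQ G xbar"
    by (simp add: weak_CRCQ_def Let_def flip: r_def q_def)
  then show ?thesis by (simp add: G_def)
qed

text \<open>Without moving the sequence, an eigenvalue shared by several constraints would allow an
  eigenvector that mixes different gradients.\<close>

lemma weak_CRCQ_diag_mat_imp:
  fixes g :: "'m::finite \<Rightarrow> real^'n \<Rightarrow> real" and xbar :: "real^'n"
  assumes cd: "\<And>i. continuously_differentiable (g i)"
    and nonneg: "\<And>i. 0 \<le> g i xbar"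
    and CRCQ: "weak_CRCQ (\<lambda>x. diag_mat (\<lambda>i. g i x)) xbar"
    and J: "J \<subseteq> {i. g i xbar = 0}" and dep: "lin_dep_family (\<lambda>i. grad (g i) xbar) J"
  shows "\<forall>\<^sub>F x in nhds xbar. lin_dep_family (\<lambda>i. grad (g i) x) J"
proof (rule ccontr)
  assume not_ev: "\<not> (\<forall>\<^sub>F x in nhds xbar. lin_dep_family (\<lambda>i. grad (g i) x) J)"
  note diff = continuously_differentiableD(1)[OF cd]
    and cont = continuously_differentiableD(2)[OF cd]
    and cont_grad = continuously_differentiableD(3)[OF cd]
  define G where "G = (\<lambda>x. diag_mat (\<lambda>i. g i x))"
  define A where "A = {i. g i xbar = 0}"
  define r where "r = rank (G xbar)"
  define q where "q = CARD('m) - r"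
  have card: "card A = q"
    by (simp add: A_def q_def r_def G_def card_zeros_diag_mat)
  \<comment> \<open>The empty family is independent, so some constraint is active; this rules out
    the case of full rank in weak-CRCQ.\<close>
  have "J \<noteq> {}"
    using dep by (auto simp: lin_dep_family_def)
  then have "q \<noteq> 0"
    using J card by (auto simp: A_def)
  then have "r \<noteq> CARD('m)"
    by (simp add: q_def)

  have "\<exists>y. y \<in> ball xbar (inverse (Suc k)) \<and> \<not> lin_dep_family (\<lambda>i. grad (g i) y) J \<and>
      (\<forall>l j. g l y = g j y \<longrightarrow> grad (g l) y = grad (g j) y)" for k
  proof -
    \<comment> \<open>The points of the ball with independent gradients form a nonempty open set.
      This leaves room to move to a point where equal values come with equal gradients.\<close>
    let ?U = "ball xbar (inverse (Suc k)) - {y. lin_dep_family (\<lambda>i. grad (g i) y) J}"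
    have "\<not> (\<forall>y\<in>ball xbar (inverse (Suc k)). lin_dep_family (\<lambda>i. grad (g i) y) J)"
      using not_ev unfolding eventually_nhds
      by (metis centre_in_ball open_ball inverse_positive_iff_positive of_nat_0_less_iff zero_less_Suc)
    then have "?U \<noteq> {}" by blast
    moreover have "open ?U"
      by (intro open_Diff open_ball closed_lin_dep_family cont_grad)
    ultimately obtain V where V: "open V" "V \<noteq> {}" "V \<subseteq> ?U"
      "\<And>i j. (\<forall>y\<in>V. g i y = g j y) \<or> (\<forall>y\<in>V. g i y \<noteq> g j y)"
      using open_subset_equal_or_nowhere_equal[of g ?U] cont by metis
    then obtain y where y: "y \<in> V" by blast
    have "grad (g l) y = grad (g j) y" if "g l y = g j y" for l j
      using V(4)[of l j] that y by (intro grad_cong_open[OF V(1) y]) blast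
    with V(3) y show ?thesis by blast
  qed
  then obtain x where x_ball: "\<And>k. x k \<in> ball xbar (inverse (Suc k))"
    and indep: "\<And>k. \<not> lin_dep_family (\<lambda>i. grad (g i) (x k)) J"
    and grad_eq: "\<And>k l j. g l (x k) = g j (x k) \<Longrightarrow> grad (g l) (x k) = grad (g j) (x k)"
    by metis
  have x: "x \<longlonglongrightarrow> xbar"
  proof (rule metric_tendsto_imp_tendsto[OF LIMSEQ_inverse_real_of_nat])
    show "\<forall>\<^sub>F k in sequentially. dist (x k) xbar \<le> dist (inverse (real (Suc k))) 0"
      using x_ball by (intro always_eventually allI) (auto simp: dist_commute less_imp_le)
  qed

  obtain I E Ebar where inf: "infinite I" and E: "\<And>k. k \<in> I \<Longrightarrow> E k \<in> eigvec_mats r (G (x k))"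
    and lim: "\<And>i. i \<in> {1..q} \<Longrightarrow> ((\<lambda>k. E k i) \<longlongrightarrow> Ebar i) (inf sequentially (principal I))"
    and transfer: "\<And>J. J \<subseteq> {1..q} \<Longrightarrow> lin_dep_family (v_diag G xbar Ebar) J \<Longrightarrow>
      \<forall>\<^sub>F k in inf sequentially (principal I). lin_dep_family (v_diag G (x k) (E k)) J"
  proof -
    let ?P = "\<lambda>(x :: nat \<Rightarrow> real^'n) I E Ebar. infinite I \<and> (\<forall>k\<in>I. E k \<in> eigvec_mats r (G (x k))) \<and>
      (\<forall>i\<in>{1..q}. ((\<lambda>k. E k i) \<longlongrightarrow> Ebar i) (inf sequentially (principal I))) \<and>
      (\<forall>J\<subseteq>{1..q}. lin_dep_family (v_diag G xbar Ebar) J \<longrightarrow>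
        (\<forall>\<^sub>F k in inf sequentially (principal I). lin_dep_family (v_diag G (x k) (E k)) J))"
    have "r = CARD('m) \<or> (\<forall>x. x \<longlonglongrightarrow> xbar \<longrightarrow> (\<exists>I E Ebar. ?P x I E Ebar))"
      using CRCQ unfolding weak_CRCQ_def Let_def G_def r_def q_def by (rule conjunct2)
    then have "\<forall>x. x \<longlonglongrightarrow> xbar \<longrightarrow> (\<exists>I E Ebar. ?P x I E Ebar)"
      using \<open>r \<noteq> CARD('m)\<close> by (elim disjE) (erule (1) notE[rotated], assumption)
    from mp[OF spec[OF this] x] obtain I E Ebar where "?P x I E Ebar"
      by (elim exE)
    then show ?thesis
      by (intro that[of I E Ebar]) simp_all
  qed

  have "\<forall>\<^sub>F k in sequentially. \<forall>a b. g a xbar = 0 \<longrightarrow> g b xbar \<noteq> 0 \<longrightarrow> g a (x k) < g b (x k)"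
    using x cont nonneg by (intro eventually_compose_filterlim[OF eventually_active_less_inactive])
  then obtain N where N: "\<And>k a b. k \<ge> N \<Longrightarrow> a \<in> A \<Longrightarrow> b \<notin> A \<Longrightarrow> g a (x k) < g b (x k)"
    unfolding eventually_sequentially A_def by auto
  have "\<exists>i\<in>{1..q}. eigval (G (x k)) (r + i) = g j (x k)" if k: "k \<ge> N" and j: "j \<in> A" for k j
  proof -
    obtain zs where zs: "distinct zs" "set zs = A"
      "\<And>i. i \<in> {1..q} \<Longrightarrow> eigval (G (x k)) (r + i) = g (zs ! (q - i)) (x k)"
      using eigval_diag_mat_smallest[of A "\<lambda>i. g i (x k)" r] N[OF k] card
      unfolding G_def q_def by metis
    moreover have "length zs = q"
      using zs card distinct_card by fastforce
    ultimately have "j \<in> (\<lambda>i. zs ! (q - i)) ` {1..q}"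
      using bij_betw_rev_nth[of zs] j by (simp add: bij_betw_def)
    then show ?thesis
      using zs(3) by auto
  qed
  \<comment> \<open>\<open>c k j\<close> is a column whose eigenvalue is the value of constraint
    \<open>j\<close>. With tied values, two constraints may be given the same column; injectivity is
    recovered later, and only on \<open>J\<close>.\<close>
  then obtain c where c: "\<And>k j. k \<ge> N \<Longrightarrow> j \<in> A \<Longrightarrow> c k j \<in> {1..q} \<and> eigval (G (x k)) (r + c k j) = g j (x k)"
    by metis

  let ?K = "I \<inter> {N..}"
  have "infinite ?K"
  proof
    assume "finite ?K"
    then have "finite (?K \<union> {..<N})" by simp
    moreover have "I \<subseteq> ?K \<union> {..<N}" by auto
    ultimately show False
      using inf finite_subset by blast
  qed
  \<comment> \<open>Restriction to \<open>A\<close> fixes the values elsewhere, so only finitely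
    many assignments of columns remain and one of them recurs infinitely often.\<close>
  moreover have "(\<lambda>k. restrict (c k) A) ` ?K \<subseteq> A \<rightarrow>\<^sub>E {1..q}"
    using c by fastforce
  then have "finite ((\<lambda>k. restrict (c k) A) ` ?K)"
    by (rule finite_subset) (intro finite_PiE, auto)
  ultimately obtain k0 where k0: "k0 \<in> ?K"
    and inf': "infinite {k \<in> ?K. restrict (c k) A = restrict (c k0) A}"
    using pigeonhole_infinite[of ?K "\<lambda>k. restrict (c k) A"] by blast
  define I' where "I' = {k \<in> ?K. restrict (c k) A = restrict (c k0) A}"
  define s where "s = c k0"
  let ?F = "inf sequentially (principal I')"
  have F_le: "?F \<le> inf sequentially (principal I)"
    by (intro inf_mono) (auto simp: I'_def)
  \<comment> \<open>Infinitude of \<open>I'\<close> makes limits along \<open>?F\<close> unique and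
    turns an eventual contradiction into an actual one.\<close>
  have F_nontrivial: "?F \<noteq> bot"
    using inf' unfolding I'_def[symmetric] trivial_limit_def eventually_inf_principal eventually_sequentially
    by (meson finite_nat_set_iff_bounded_le nle_le)
  have s: "s j \<in> {1..q}" "\<And>k. k \<in> I' \<Longrightarrow> eigval (G (x k)) (r + s j) = g j (x k)" if "j \<in> A" for j
  proof -
    show "s j \<in> {1..q}"
      using c[of k0 j] k0 that by (simp add: s_def)
    fix k assume "k \<in> I'"
    then have "k \<ge> N" "c k j = s j"
      using that by (auto simp: I'_def s_def restrict_def fun_eq_iff split: if_splits)
    with c[of k j] that show "eigval (G (x k)) (r + s j) = g j (x k)" by simp
  qed

  have v_eq: "v_diag G (x k) (E k) (s j) = grad (g j) (x k)" if "k \<in> I'" "j \<in> A" for k j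
  proof -
    have "E k \<in> eigvec_mats r (G (x k))"
      using E that(1) by (simp add: I'_def)
    then have "G (x k) *v E k (s j) = g j (x k) *\<^sub>R E k (s j)" "E k (s j) \<bullet> E k (s j) = 1"
      using s[OF that(2)] that(1) by (auto simp: eigvec_mats_def q_def)
    then show ?thesis
      unfolding G_def by (rule v_diag_diag_mat_eigenvector[where j = j, OF diff]) (rule grad_eq)
  qed
  \<comment> \<open>At \<open>xbar\<close> all active constraints tie at 0 while their gradients may
    differ, so the eigenvector argument does not apply there. The identity is obtained instead as
    the limit of \<open>v_eq\<close> along \<open>I'\<close>.\<close>
  have v_eq_lim: "v_diag G xbar Ebar (s j) = grad (g j) xbar" if j: "j \<in> A" for j
  proof -
    have x': "(x \<longlongrightarrow> xbar) ?F"
      using x by (rule tendsto_mono[rotated]) simp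
    have grad_lim: "((\<lambda>k. grad (g l) (x k)) \<longlongrightarrow> grad (g l) xbar) ?F" for l
      using continuous_on_tendsto_compose[OF cont_grad x'] by simp
    have "((\<lambda>k. E k (s j)) \<longlongrightarrow> Ebar (s j)) ?F"
      using lim[OF s(1)[OF j]] F_le by (rule tendsto_mono[rotated])
    then have "((\<lambda>k. v_diag G (x k) (E k) (s j)) \<longlongrightarrow> v_diag G xbar Ebar (s j)) ?F"
      unfolding G_def v_diag_diag_mat[OF diff] by (intro tendsto_intros grad_lim)
    moreover have "\<forall>\<^sub>F k in ?F. v_diag G (x k) (E k) (s j) = grad (g j) (x k)"
      using v_eq j by (simp add: eventually_inf_principal)
    ultimately have "((\<lambda>k. grad (g j) (x k)) \<longlongrightarrow> v_diag G xbar Ebar (s j)) ?F"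
      by (simp add: tendsto_cong)
    then show ?thesis
      using grad_lim F_nontrivial tendsto_unique by blast
  qed

  obtain k1 where k1: "k1 \<in> I'"
    using inf' unfolding I'_def by (metis equals0I finite.emptyI)
  have "J \<subseteq> A"
    using J by (simp add: A_def)
  \<comment> \<open>A column shared by two members of \<open>J\<close> would give them equal
    gradients at \<open>x k1\<close>, contradicting independence there.\<close>
  have inj: "inj_on s J"
  proof (rule inj_onI, rule ccontr)
    fix a b assume ab: "a \<in> J" "b \<in> J" "s a = s b" "a \<noteq> b"
    then have "grad (g a) (x k1) = grad (g b) (x k1)"
      using v_eq[OF k1] \<open>J \<subseteq> A\<close> by (metis subsetD)
    then show False
      using lin_dep_family_eq_members[of J a b "\<lambda>i. grad (g i) (x k1)"] ab indep[of k1] by simp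
  qed
  have "lin_dep_family (v_diag G xbar Ebar) (s ` J) \<longleftrightarrow> lin_dep_family (\<lambda>i. grad (g i) xbar) J"
    unfolding lin_dep_family_reindex[OF inj] using v_eq_lim \<open>J \<subseteq> A\<close> by (intro lin_dep_family_cong) auto
  then have "\<forall>\<^sub>F k in inf sequentially (principal I). lin_dep_family (v_diag G (x k) (E k)) (s ` J)"
    using dep s(1) \<open>J \<subseteq> A\<close> by (intro transfer) auto
  then have "\<forall>\<^sub>F k in ?F. lin_dep_family (v_diag G (x k) (E k)) (s ` J)"
    using F_le by (rule filter_leD[rotated])
  moreover have "\<forall>\<^sub>F k in ?F. k \<in> I'"
    by (simp add: eventually_inf_principal)
  ultimately have "\<forall>\<^sub>F k in ?F. False"
  proof eventually_elim
    case (elim k)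
    have "lin_dep_family (v_diag G (x k) (E k)) (s ` J) \<longleftrightarrow> lin_dep_family (\<lambda>i. grad (g i) (x k)) J"
      unfolding lin_dep_family_reindex[OF inj] using v_eq elim(2) \<open>J \<subseteq> A\<close>
      by (intro lin_dep_family_cong) auto
    with elim(1) indep show False by simp
  qed
  with F_nontrivial show False
    by (simp add: trivial_limit_def)
qed

theorem proposition3p1:
  fixes g :: "'m::finite \<Rightarrow> real^'n \<Rightarrow> real" and xbar :: "real^'n"
  assumes "\<And>i. continuously_differentiable (g i)"
    and "\<And>i. 0 \<le> g i xbar"
  shows "weak_CRCQ (\<lambda>x. diag_mat (\<lambda>i. g i x)) xbar \<longleftrightarrow>
    (\<forall>J\<subseteq>{i. g i xbar = 0}. lin_dep_family (\<lambda>i. grad (g i) xbar) J \<longrightarrow>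
      (\<forall>\<^sub>F x in nhds xbar. lin_dep_family (\<lambda>i. grad (g i) x) J))"
  using weak_CRCQ_diag_mat_if[of g xbar] weak_CRCQ_diag_mat_imp[of g xbar] assms by blast

end
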